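(* The proof system $\mathbf{MSL}$ is complete for the logic $\mathsf{MSL}$: for every formula $\varphi\in\mathcal{L}_{\mathsf{MSL}}$, if $\varphi$ is valid (i.e. true at every state of every Kripke model), then $\vdash_{\mathbf{MSL}}\varphi$.
   Context: Language. Let $\mathbf{P}$ be a countable set of propositional letters. $\mathcal{L}_{\mathsf{MSL}}$ is given by $\varphi::=p\mid\neg\varphi\mid\varphi\land\varphi\mid\Diamond\varphi\mid\langle p:=\varphi\rangle\varphi$ with $p\in\mathbf{P}$. $\top,\bot,\lor,\to,\leftrightarrow$ are the usual abbreviations; $\Box$ and $[p:=\psi]$ are the duals of $\Diamond$ and $\langle p:=\psi\rangle$, i.e. $\Box\varphi$ is $\neg\Diamond\neg\varphi$ and $[p:=\psi]\varphi$ is $\neg\langle p:=\psi\rangle\neg\varphi$. Semantics. A (Kripke) model is $M=(W,R,V)$ with $W\neq\emptyset$, $R\subseteq W\times W$, $V:\mathbf{P}\to 2^W$. Truth: $M,w\vDash p$ iff $w\in V(p)$; Boolean connectives as usual; $M,w\vDash\Diamond\varphi$ iff $M,v\vDash\varphi$ for some $v$ with $Rwv$; $M,w\vDash\langle p:=\psi\rangle\varphi$ iff $M|_{p:=\psi},w\vDash\varphi$, where $M|_{p:=\psi}=(W,R,V')$ with $V'(p)=\{v\in W: M,v\vDash\psi\}$ and $V'(q)=V(q)$ for $q\neq p$. Proof system $\mathbf{MSL}$ (schemata; $\vdash_{\mathbf{MSL}}\varphi$ means $\varphi$ is provable). Basic axioms: (A1) $\varphi\to(\psi\to\varphi)$;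 (A2) $(\varphi\to(\psi\to\chi))\to((\varphi\to\psi)\to(\varphi\to\chi))$; (A3) $(\neg\varphi\to\neg\psi)\to(\psi\to\varphi)$; (Dual) $\Diamond\varphi\leftrightarrow\neg\Box\neg\varphi$; (K$_\Box$) $\Box(\varphi\to\psi)\to(\Box\varphi\to\Box\psi)$; (K$_{[\,]}$) $[p:=\chi](\varphi\to\psi)\to([p:=\chi]\varphi\to[p:=\chi]\psi)$. Recursion axioms: (R1) $[p:=\chi]q\leftrightarrow q$ for $q\neq p$; (R2) $[p:=\chi]p\leftrightarrow\chi$; (R3) $[p:=\chi]\neg\varphi\leftrightarrow\neg[p:=\chi]\varphi$; (R4) $[p:=\chi](\varphi\land\psi)\leftrightarrow[p:=\chi]\varphi\land[p:=\chi]\psi$; (R5) $[p:=\chi]\Box\varphi\leftrightarrow\Box[p:=\chi]\varphi$. Rules: (MP) from $\varphi$ and $\varphi\to\psi$ infer $\psi$; (Nec$_\Box$) from $\varphi$ infer $\Box\varphi$; (Nec$_{[\,]}$) from $\varphi$ infer $[p:=\chi]\varphi$. Conventions: (A1)-(A3) with (MP) are understood as a complete axiomatization of classical propositional logic for all the connectives (with their usual interdefinability), and $\langle p:=\chi\rangle\varphi$ is interchangeable with $\neg[p:=\chi]\neg\varphi$. *)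

theory Defs
  imports "HOL-Library.Countable" "HOL-Library.Infinite_Typeclass"
begin

section \<open>Language\<close>

datatype 'p fm =
    Prop 'p
  | Neg "'p fm"                          (\<open>\<^bold>\<not> _\<close> [70] 70)
  | Conj "'p fm" "'p fm"                 (infixr \<open>\<^bold>\<and>\<close> 65)
  | Dia "'p fm"                          (\<open>\<^bold>\<diamond> _\<close> [70] 70)
  | Assign 'p "'p fm" "'p fm"            (\<open>\<^bold>\<langle>_ \<^bold>:= _\<^bold>\<rangle> _\<close> [0, 0, 70] 70)

abbreviation Imp :: "'p fm \<Rightarrow> 'p fm \<Rightarrow> 'p fm" (infixr \<open>\<^bold>\<longrightarrow>\<close> 55) where
  "\<phi> \<^bold>\<longrightarrow> \<psi> \<equiv> \<^bold>\<not> (\<phi> \<^bold>\<and> \<^bold>\<not> \<psi>)"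

abbreviation Iff :: "'p fm \<Rightarrow> 'p fm \<Rightarrow> 'p fm" (infix \<open>\<^bold>\<longleftrightarrow>\<close> 50) where
  "\<phi> \<^bold>\<longleftrightarrow> \<psi> \<equiv> (\<phi> \<^bold>\<longrightarrow> \<psi>) \<^bold>\<and> (\<psi> \<^bold>\<longrightarrow> \<phi>)"

abbreviation Box :: "'p fm \<Rightarrow> 'p fm" (\<open>\<^bold>\<box> _\<close> [70] 70) where
  "\<^bold>\<box> \<phi> \<equiv> \<^bold>\<not> \<^bold>\<diamond> \<^bold>\<not> \<phi>"

abbreviation BoxAssign :: "'p \<Rightarrow> 'p fm \<Rightarrow> 'p fm \<Rightarrow> 'p fm" (\<open>\<^bold>[_ \<^bold>:= _\<^bold>] _\<close> [0, 0, 70] 70) where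
  "\<^bold>[p \<^bold>:= \<psi>\<^bold>] \<phi> \<equiv> \<^bold>\<not> \<^bold>\<langle>p \<^bold>:= \<psi>\<^bold>\<rangle> \<^bold>\<not> \<phi>"


section \<open>Semantics\<close>

record ('w, 'p) model =
  worlds :: "'w set"
  rel :: "('w \<times> 'w) set"
  val :: "'p \<Rightarrow> 'w set"

definition kripke_model :: "('w, 'p) model \<Rightarrow> bool" where
  "kripke_model M \<longleftrightarrow>
     worlds M \<noteq> {} \<and> rel M \<subseteq> worlds M \<times> worlds M \<and> (\<forall>p. val M p \<subseteq> worlds M)"

primrec sat :: "('w, 'p) model \<Rightarrow> 'w \<Rightarrow> 'p fm \<Rightarrow> bool" (\<open>_, _ \<Turnstile> _\<close> [50, 50, 50] 50) where
  "(M, w \<Turnstile> Prop p) \<longleftrightarrow> w \<in> val M p"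
| "(M, w \<Turnstile> \<^bold>\<not> \<phi>) \<longleftrightarrow> \<not> (M, w \<Turnstile> \<phi>)"
| "(M, w \<Turnstile> \<phi> \<^bold>\<and> \<psi>) \<longleftrightarrow> (M, w \<Turnstile> \<phi>) \<and> (M, w \<Turnstile> \<psi>)"
| "(M, w \<Turnstile> \<^bold>\<diamond> \<phi>) \<longleftrightarrow> (\<exists>v. (w, v) \<in> rel M \<and> (M, v \<Turnstile> \<phi>))"
| "(M, w \<Turnstile> \<^bold>\<langle>p \<^bold>:= \<psi>\<^bold>\<rangle> \<phi>) \<longleftrightarrow>
     (M\<lparr>val := (val M)(p := {v \<in> worlds M. M, v \<Turnstile> \<psi>})\<rparr>, w \<Turnstile> \<phi>)"

text \<open>
  HOL cannot quantify over all types inside a formula, so the type \<open>'w\<close> from which the worlds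
  of the models are drawn is a parameter. A formula that is valid in the usual sense satisfies
  \<open>valid\<close> at every type. The models range over all nonempty subsets of \<open>'w\<close>, so an infinite
  type offers every finite (and every countable) model up to isomorphism. At a finite type
  \<open>valid\<close> is too weak: a single world, for instance, validates formulas that are not valid.
\<close>

definition valid :: "'w itself \<Rightarrow> 'p fm \<Rightarrow> bool" where
  "valid _ \<phi> \<longleftrightarrow>
     (\<forall>M :: ('w, 'p) model. kripke_model M \<longrightarrow> (\<forall>w \<in> worlds M. M, w \<Turnstile> \<phi>))"


section \<open>Proof system\<close>

text \<open>
  \<open>A1\<close>--\<open>A3\<close> only speak about negation and implication. As conjunction is primitive and
  implication is an abbreviation, they do not by themselves axiomatise conjunction (with
  conjunctions not of the form of an implication left opaque); \<open>ConjE\<close> and \<open>ConjI\<close>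
  are the usual interdefinability of conjunction with negation and implication.

  \<open>DualAssign\<close> is the interchangeability of the diamond \<open>\<^bold>\<langle>p \<^bold>:= \<chi>\<^bold>\<rangle> \<phi>\<close> with
  \<open>\<^bold>\<not> \<^bold>[p \<^bold>:= \<chi>\<^bold>] \<^bold>\<not> \<phi>\<close>. Neither this nor \<open>Dual\<close> is a mere
  instance of double negation: the boxes are abbreviations, so both axioms also relate \<open>\<phi>\<close>
  and \<open>\<^bold>\<not> \<^bold>\<not> \<phi>\<close> under the modality.
\<close>

inductive MSL :: "'p fm \<Rightarrow> bool" (\<open>\<turnstile>\<^sub>M\<^sub>S\<^sub>L _\<close> [50] 50) where
  A1: "\<turnstile>\<^sub>M\<^sub>S\<^sub>L \<phi> \<^bold>\<longrightarrow> (\<psi> \<^bold>\<longrightarrow> \<phi>)"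
| A2: "\<turnstile>\<^sub>M\<^sub>S\<^sub>L (\<phi> \<^bold>\<longrightarrow> (\<psi> \<^bold>\<longrightarrow> \<chi>)) \<^bold>\<longrightarrow> ((\<phi> \<^bold>\<longrightarrow> \<psi>) \<^bold>\<longrightarrow> (\<phi> \<^bold>\<longrightarrow> \<chi>))"
| A3: "\<turnstile>\<^sub>M\<^sub>S\<^sub>L (\<^bold>\<not> \<phi> \<^bold>\<longrightarrow> \<^bold>\<not> \<psi>) \<^bold>\<longrightarrow> (\<psi> \<^bold>\<longrightarrow> \<phi>)"
| ConjE: "\<turnstile>\<^sub>M\<^sub>S\<^sub>L (\<phi> \<^bold>\<and> \<psi>) \<^bold>\<longrightarrow> \<^bold>\<not> (\<phi> \<^bold>\<longrightarrow> \<^bold>\<not> \<psi>)"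
| ConjI: "\<turnstile>\<^sub>M\<^sub>S\<^sub>L \<^bold>\<not> (\<phi> \<^bold>\<longrightarrow> \<^bold>\<not> \<psi>) \<^bold>\<longrightarrow> (\<phi> \<^bold>\<and> \<psi>)"
| Dual: "\<turnstile>\<^sub>M\<^sub>S\<^sub>L \<^bold>\<diamond> \<phi> \<^bold>\<longleftrightarrow> \<^bold>\<not> \<^bold>\<box> \<^bold>\<not> \<phi>"
| DualAssign: "\<turnstile>\<^sub>M\<^sub>S\<^sub>L \<^bold>\<langle>p \<^bold>:= \<chi>\<^bold>\<rangle> \<phi> \<^bold>\<longleftrightarrow> \<^bold>\<not> \<^bold>[p \<^bold>:= \<chi>\<^bold>] \<^bold>\<not> \<phi>"
| KBox: "\<turnstile>\<^sub>M\<^sub>S\<^sub>L \<^bold>\<box> (\<phi> \<^bold>\<longrightarrow> \<psi>) \<^bold>\<longrightarrow> (\<^bold>\<box> \<phi> \<^bold>\<longrightarrow> \<^bold>\<box> \<psi>)"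
| KAssign: "\<turnstile>\<^sub>M\<^sub>S\<^sub>L \<^bold>[p \<^bold>:= \<chi>\<^bold>] (\<phi> \<^bold>\<longrightarrow> \<psi>) \<^bold>\<longrightarrow> (\<^bold>[p \<^bold>:= \<chi>\<^bold>] \<phi> \<^bold>\<longrightarrow> \<^bold>[p \<^bold>:= \<chi>\<^bold>] \<psi>)"
| R1: "q \<noteq> p \<Longrightarrow> \<turnstile>\<^sub>M\<^sub>S\<^sub>L \<^bold>[p \<^bold>:= \<chi>\<^bold>] Prop q \<^bold>\<longleftrightarrow> Prop q"
| R2: "\<turnstile>\<^sub>M\<^sub>S\<^sub>L \<^bold>[p \<^bold>:= \<chi>\<^bold>] Prop p \<^bold>\<longleftrightarrow> \<chi>"
| R3: "\<turnstile>\<^sub>M\<^sub>S\<^sub>L \<^bold>[p \<^bold>:= \<chi>\<^bold>] \<^bold>\<not> \<phi> \<^bold>\<longleftrightarrow> \<^bold>\<not> \<^bold>[p \<^bold>:= \<chi>\<^bold>] \<phi>"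
| R4: "\<turnstile>\<^sub>M\<^sub>S\<^sub>L \<^bold>[p \<^bold>:= \<chi>\<^bold>] (\<phi> \<^bold>\<and> \<psi>) \<^bold>\<longleftrightarrow> (\<^bold>[p \<^bold>:= \<chi>\<^bold>] \<phi> \<^bold>\<and> \<^bold>[p \<^bold>:= \<chi>\<^bold>] \<psi>)"
| R5: "\<turnstile>\<^sub>M\<^sub>S\<^sub>L \<^bold>[p \<^bold>:= \<chi>\<^bold>] \<^bold>\<box> \<phi> \<^bold>\<longleftrightarrow> \<^bold>\<box> \<^bold>[p \<^bold>:= \<chi>\<^bold>] \<phi>"
| MP: "\<turnstile>\<^sub>M\<^sub>S\<^sub>L \<phi> \<Longrightarrow> \<turnstile>\<^sub>M\<^sub>S\<^sub>L \<phi> \<^bold>\<longrightarrow> \<psi> \<Longrightarrow> \<turnstile>\<^sub>M\<^sub>S\<^sub>L \<psi>"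
| NecBox: "\<turnstile>\<^sub>M\<^sub>S\<^sub>L \<phi> \<Longrightarrow> \<turnstile>\<^sub>M\<^sub>S\<^sub>L \<^bold>\<box> \<phi>"
| NecAssign: "\<turnstile>\<^sub>M\<^sub>S\<^sub>L \<phi> \<Longrightarrow> \<turnstile>\<^sub>M\<^sub>S\<^sub>L \<^bold>[p \<^bold>:= \<chi>\<^bold>] \<phi>"

end

theory Submission
  imports Defs
begin

text \<open>
  The proof combines the two classical ingredients of completeness for a logic with recursion
  axioms.

  \<^emph>\<open>Elimination of assignments.\<close> An assignment \<open>\<^bold>\<langle>p \<^bold>:= \<chi>\<^bold>\<rangle>\<close> in front of an assignment-free
  formula has the effect of the substitution of \<open>\<chi>\<close> for \<open>p\<close>. This holds semantically
  (\<open>sat_subst\<close>), and the recursion axioms are exactly the induction steps needed to prove it in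
  the calculus (\<open>peq_Assign_subst\<close>). Working from the inside out, every formula \<open>\<phi>\<close> becomes
  an assignment-free formula \<open>static_form \<phi>\<close> that is both semantically and provably
  equivalent to it, so that only basic modal formulas remain to be treated.

  \<^emph>\<open>Finite countermodels for basic modal formulas.\<close> If an assignment-free \<open>\<phi>\<close> is not provable,
  Lindenbaum's lemma gives a maximal consistent set that omits it. The canonical model on all
  maximal consistent sets refutes \<open>\<phi>\<close>, but it is in general uncountable and need not fit
  into the given type of worlds. Its smallest filtration through the finite set of
  subformulas of \<open>\<phi>\<close> is finite, so it can be copied into any infinite type
  (\<open>countermodel\<close>).

  Lindenbaum's lemma also shows that provability is membership in all maximal consistent sets
  (\<open>provable_iff_mcs\<close>). On such a set negation and conjunction behave classically, so
  propositional reasoning inside the calculus becomes propositional reasoning about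
  membership.
\<close>

section \<open>Maximal consistent sets\<close>

text \<open>
  Necessitation is confined to theorems: the hypotheses in \<open>\<Gamma>\<close> are local, which is what makes
  the deduction theorem true.
\<close>

inductive derives :: "'p fm set \<Rightarrow> 'p fm \<Rightarrow> bool" for \<Gamma> :: "'p fm set" where
  theorem_derives: "\<turnstile>\<^sub>M\<^sub>S\<^sub>L \<phi> \<Longrightarrow> derives \<Gamma> \<phi>"
| hyp_derives: "\<phi> \<in> \<Gamma> \<Longrightarrow> derives \<Gamma> \<phi>"
| mp_derives: "derives \<Gamma> \<phi> \<Longrightarrow> derives \<Gamma> (\<phi> \<^bold>\<longrightarrow> \<psi>) \<Longrightarrow> derives \<Gamma> \<psi>"

lemma derives_mono: "derives \<Gamma> \<phi> \<Longrightarrow> \<Gamma> \<subseteq> \<Delta> \<Longrightarrow> derives \<Delta> \<phi>"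
  by (induction rule: derives.induct) (auto intro: derives.intros)

lemma derives_empty_iff: "derives {} \<phi> \<longleftrightarrow> \<turnstile>\<^sub>M\<^sub>S\<^sub>L \<phi>"
proof
  show "derives {} \<phi> \<Longrightarrow> \<turnstile>\<^sub>M\<^sub>S\<^sub>L \<phi>"
    by (induction rule: derives.induct) (auto intro: MSL.MP)
qed (rule theorem_derives)

lemma derives_finite: "derives \<Gamma> \<phi> \<Longrightarrow> \<exists>F. finite F \<and> F \<subseteq> \<Gamma> \<and> derives F \<phi>"
proof (induction rule: derives.induct)
  case (theorem_derives \<phi>)
  then show ?case by (intro exI[of _ "{}"]) (auto intro: derives.intros)
next
  case (hyp_derives \<phi>)
  then show ?case by (intro exI[of _ "{\<phi>}"]) (auto intro: derives.intros)
next
  case (mp_derives \<phi> \<psi>)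
  then obtain F G where FG: "finite F" "F \<subseteq> \<Gamma>" "derives F \<phi>"
    "finite G" "G \<subseteq> \<Gamma>" "derives G (\<phi> \<^bold>\<longrightarrow> \<psi>)" by blast
  then have "derives (F \<union> G) \<psi>"
    by (meson derives.mp_derives derives_mono sup_ge1 sup_ge2)
  then show ?case using FG by (intro exI[of _ "F \<union> G"]) auto
qed

lemma derives_weaken: "derives \<Gamma> \<psi> \<Longrightarrow> derives \<Gamma> (\<phi> \<^bold>\<longrightarrow> \<psi>)"
  by (rule mp_derives[OF _ theorem_derives[OF A1]])

lemma derives_contrapos: "derives \<Gamma> (\<^bold>\<not> \<phi> \<^bold>\<longrightarrow> \<^bold>\<not> \<psi>) \<Longrightarrow> derives \<Gamma> (\<psi> \<^bold>\<longrightarrow> \<phi>)"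
  by (rule mp_derives[OF _ theorem_derives[OF A3]])

lemma derives_imp_refl: "derives \<Gamma> (\<phi> \<^bold>\<longrightarrow> \<phi>)"
  using mp_derives[OF theorem_derives[OF A1[of \<phi> "\<phi>"]]
      mp_derives[OF theorem_derives[OF A1[of \<phi> "\<phi> \<^bold>\<longrightarrow> \<phi>"]] theorem_derives[OF A2]]] .

lemma deduction: "derives (insert \<phi> \<Gamma>) \<psi> \<Longrightarrow> derives \<Gamma> (\<phi> \<^bold>\<longrightarrow> \<psi>)"
proof (induction rule: derives.induct)
  case (theorem_derives \<psi>)
  then show ?case by (intro derives_weaken derives.theorem_derives)
next
  case (hyp_derives \<psi>)
  then show ?case by (auto intro: derives_weaken derives_imp_refl derives.hyp_derives)
next
  case (mp_derives \<psi> \<chi>)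
  then show ?case by (meson derives.mp_derives derives.theorem_derives A2)
qed

lemma ex_falso: "derives \<Gamma> (\<^bold>\<not> \<phi>) \<Longrightarrow> derives \<Gamma> (\<phi> \<^bold>\<longrightarrow> \<psi>)"
  by (rule derives_contrapos[OF derives_weaken])

text \<open>
  Falsity is the negation of an arbitrary theorem, for which an instance of \<open>A1\<close> serves. In
  this form \<open>A3\<close> immediately turns a refutation of \<open>\<^bold>\<not> \<phi>\<close> into a derivation of \<open>\<phi>\<close>.
\<close>

definition Verum :: "'p fm" where
  "Verum = (Prop undefined \<^bold>\<longrightarrow> (Prop undefined \<^bold>\<longrightarrow> Prop undefined))"

definition consistent :: "'p fm set \<Rightarrow> bool" where
  "consistent \<Gamma> \<longleftrightarrow> \<not> derives \<Gamma> (\<^bold>\<not> Verum)"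

definition mcs :: "'p fm set \<Rightarrow> bool" where
  "mcs \<Gamma> \<longleftrightarrow> consistent \<Gamma> \<and> (\<forall>\<phi>. \<phi> \<notin> \<Gamma> \<longrightarrow> \<not> consistent (insert \<phi> \<Gamma>))"

lemma derives_Verum: "derives \<Gamma> Verum"
  unfolding Verum_def by (rule theorem_derives[OF A1])

lemma consistent_insert_Neg:
  assumes "\<not> derives \<Gamma> \<phi>"
  shows "consistent (insert (\<^bold>\<not> \<phi>) \<Gamma>)"
  unfolding consistent_def
proof
  assume "derives (insert (\<^bold>\<not> \<phi>) \<Gamma>) (\<^bold>\<not> Verum)"
  then have "derives \<Gamma> (Verum \<^bold>\<longrightarrow> \<phi>)"
    by (rule derives_contrapos[OF deduction])
  with assms show False
    using mp_derives[OF derives_Verum] by blast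
qed

lemma consistent_chain_Union:
  assumes chain: "C \<in> chains {\<Delta>. consistent \<Delta>}" and "C \<noteq> {}"
  shows "consistent (\<Union>C)"
  unfolding consistent_def
proof
  assume "derives (\<Union>C) (\<^bold>\<not> Verum)"
  then obtain F where F: "finite F" "F \<subseteq> \<Union>C" "derives F (\<^bold>\<not> Verum)"
    using derives_finite by blast
  have "subset.chain {\<Delta>. consistent \<Delta>} C"
    using chain by (simp add: chains_alt_def)
  then obtain \<Delta> where "\<Delta> \<in> C" "F \<subseteq> \<Delta>"
    using finite_subset_Union_chain[OF F(1,2) \<open>C \<noteq> {}\<close>] by blast
  then have "derives \<Delta> (\<^bold>\<not> Verum)" "consistent \<Delta>"
    using F(3) derives_mono chain by (auto simp: chains_def)
  then show False by (simp add: consistent_def)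
qed

lemma lindenbaum:
  assumes "\<not> derives \<Gamma> \<phi>"
  obtains \<Delta> where "mcs \<Delta>" "\<Gamma> \<subseteq> \<Delta>" "\<^bold>\<not> \<phi> \<in> \<Delta>"
proof -
  let ?\<Gamma> = "insert (\<^bold>\<not> \<phi>) \<Gamma>"
  let ?S = "{\<Delta>. ?\<Gamma> \<subseteq> \<Delta> \<and> consistent \<Delta>}"
  have "\<exists>\<Delta>\<in>?S. \<forall>\<Theta>\<in>?S. \<Delta> \<subseteq> \<Theta> \<longrightarrow> \<Theta> = \<Delta>"
  proof (rule subset_Zorn_nonempty)
    show "?S \<noteq> {}"
      using consistent_insert_Neg[OF assms] by blast
    fix C assume C: "C \<noteq> {}" "subset.chain ?S C"
    then have "C \<in> chains {\<Delta>. consistent \<Delta>}"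
      by (auto simp: chains_alt_def subset.chain_def)
    with C show "\<Union>C \<in> ?S"
      using consistent_chain_Union by (fastforce simp: subset.chain_def)
  qed
  then obtain \<Delta> where \<Delta>: "\<Delta> \<in> ?S" and max: "\<forall>\<Theta>\<in>?S. \<Delta> \<subseteq> \<Theta> \<longrightarrow> \<Theta> = \<Delta>"
    by (rule bexE)
  have "\<not> consistent (insert \<psi> \<Delta>)" if "\<psi> \<notin> \<Delta>" for \<psi>
  proof
    assume "consistent (insert \<psi> \<Delta>)"
    with \<Delta> have "insert \<psi> \<Delta> \<in> ?S" by auto
    with max have "insert \<psi> \<Delta> = \<Delta>" by (meson subset_insertI)
    with that show False by auto
  qed
  with \<Delta> have "mcs \<Delta>"
    by (simp add: mcs_def)
  moreover have "\<Gamma> \<subseteq> \<Delta>" "\<^bold>\<not> \<phi> \<in> \<Delta>"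
    using \<Delta> by auto
  ultimately show thesis
    by (rule that)
qed

lemma mcs_closed:
  assumes "mcs \<Gamma>" "derives \<Gamma> \<phi>"
  shows "\<phi> \<in> \<Gamma>"
proof (rule ccontr)
  assume "\<phi> \<notin> \<Gamma>"
  then have "derives \<Gamma> (\<phi> \<^bold>\<longrightarrow> \<^bold>\<not> Verum)"
    using assms(1) by (intro deduction) (simp add: mcs_def consistent_def)
  with assms(2) have "derives \<Gamma> (\<^bold>\<not> Verum)"
    by (rule mp_derives)
  with assms(1) show False
    by (simp add: mcs_def consistent_def)
qed

lemma mcs_theorem: "mcs \<Gamma> \<Longrightarrow> \<turnstile>\<^sub>M\<^sub>S\<^sub>L \<phi> \<Longrightarrow> \<phi> \<in> \<Gamma>"
  by (intro mcs_closed theorem_derives)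

lemma mcs_Neg:
  assumes "mcs \<Gamma>"
  shows "\<^bold>\<not> \<phi> \<in> \<Gamma> \<longleftrightarrow> \<phi> \<notin> \<Gamma>"
proof
  assume neg: "\<^bold>\<not> \<phi> \<in> \<Gamma>"
  show "\<phi> \<notin> \<Gamma>"
  proof
    assume "\<phi> \<in> \<Gamma>"
    then have "derives \<Gamma> (\<^bold>\<not> Verum)"
      by (rule mp_derives[OF hyp_derives ex_falso[OF hyp_derives[OF neg]]])
    with assms show False
      by (simp add: mcs_def consistent_def)
  qed
next
  assume "\<phi> \<notin> \<Gamma>"
  then have "\<not> derives \<Gamma> \<phi>"
    using mcs_closed[OF assms] by blast
  then have "consistent (insert (\<^bold>\<not> \<phi>) \<Gamma>)"
    by (rule consistent_insert_Neg)
  then show "\<^bold>\<not> \<phi> \<in> \<Gamma>"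
    using assms by (auto simp: mcs_def)
qed

text \<open>
  Implication comes before conjunction: the axioms \<open>A1\<close>--\<open>A3\<close> determine it, and
  \<open>ConjE\<close> and \<open>ConjI\<close> then transfer the result to conjunctions.
\<close>

lemma mcs_Imp:
  assumes "mcs \<Gamma>"
  shows "(\<phi> \<^bold>\<longrightarrow> \<psi>) \<in> \<Gamma> \<longleftrightarrow> (\<phi> \<in> \<Gamma> \<longrightarrow> \<psi> \<in> \<Gamma>)"
proof
  assume "(\<phi> \<^bold>\<longrightarrow> \<psi>) \<in> \<Gamma>"
  then show "\<phi> \<in> \<Gamma> \<longrightarrow> \<psi> \<in> \<Gamma>"
    using mcs_closed[OF assms mp_derives[OF hyp_derives hyp_derives]] by blast
next
  assume "\<phi> \<in> \<Gamma> \<longrightarrow> \<psi> \<in> \<Gamma>"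
  then have "\<^bold>\<not> \<phi> \<in> \<Gamma> \<or> \<psi> \<in> \<Gamma>"
    using mcs_Neg[OF assms] by blast
  then have "derives \<Gamma> (\<phi> \<^bold>\<longrightarrow> \<psi>)"
    using ex_falso[OF hyp_derives] derives_weaken[OF hyp_derives] by blast
  then show "(\<phi> \<^bold>\<longrightarrow> \<psi>) \<in> \<Gamma>"
    by (rule mcs_closed[OF assms])
qed

lemma mcs_Conj:
  assumes "mcs \<Gamma>"
  shows "(\<phi> \<^bold>\<and> \<psi>) \<in> \<Gamma> \<longleftrightarrow> \<phi> \<in> \<Gamma> \<and> \<psi> \<in> \<Gamma>"
proof -
  have "(\<phi> \<^bold>\<and> \<psi>) \<in> \<Gamma> \<longleftrightarrow> \<^bold>\<not> (\<phi> \<^bold>\<longrightarrow> \<^bold>\<not> \<psi>) \<in> \<Gamma>"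
    using mcs_theorem[OF assms ConjE[of \<phi> \<psi>]] mcs_theorem[OF assms ConjI[of \<phi> \<psi>]]
    unfolding mcs_Imp[OF assms] by blast
  also have "\<dots> \<longleftrightarrow> \<phi> \<in> \<Gamma> \<and> \<psi> \<in> \<Gamma>"
    using mcs_Imp[OF assms, of \<phi> "\<^bold>\<not> \<psi>"] mcs_Neg[OF assms, of \<psi>]
      mcs_Neg[OF assms, of "\<phi> \<^bold>\<longrightarrow> \<^bold>\<not> \<psi>"] by blast
  finally show ?thesis .
qed

lemma provable_iff_mcs: "\<turnstile>\<^sub>M\<^sub>S\<^sub>L \<phi> \<longleftrightarrow> (\<forall>\<Gamma>. mcs \<Gamma> \<longrightarrow> \<phi> \<in> \<Gamma>)"
proof
  show "\<turnstile>\<^sub>M\<^sub>S\<^sub>L \<phi> \<Longrightarrow> \<forall>\<Gamma>. mcs \<Gamma> \<longrightarrow> \<phi> \<in> \<Gamma>"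
    using mcs_theorem by blast
  show "\<turnstile>\<^sub>M\<^sub>S\<^sub>L \<phi>" if all: "\<forall>\<Gamma>. mcs \<Gamma> \<longrightarrow> \<phi> \<in> \<Gamma>"
  proof (rule ccontr)
    assume "\<not> \<turnstile>\<^sub>M\<^sub>S\<^sub>L \<phi>"
    then have "\<not> derives {} \<phi>"
      by (simp add: derives_empty_iff)
    then obtain \<Gamma> where "mcs \<Gamma>" "\<^bold>\<not> \<phi> \<in> \<Gamma>"
      by (rule lindenbaum)
    with all show False
      by (simp add: mcs_Neg)
  qed
qed


section \<open>Provable equivalence\<close>

text \<open>
  By \<open>provable_iff_mcs\<close> this is provability of the biconditional, put in the form in which it
  can be used for rewriting.
\<close>

definition peq :: "'p fm \<Rightarrow> 'p fm \<Rightarrow> bool" (infix \<open>\<approx>\<close> 50) where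
  "\<phi> \<approx> \<psi> \<longleftrightarrow> (\<forall>\<Gamma>. mcs \<Gamma> \<longrightarrow> (\<phi> \<in> \<Gamma> \<longleftrightarrow> \<psi> \<in> \<Gamma>))"

lemma peq_if_provable_Iff: "\<turnstile>\<^sub>M\<^sub>S\<^sub>L \<phi> \<^bold>\<longleftrightarrow> \<psi> \<Longrightarrow> \<phi> \<approx> \<psi>"
  by (auto simp: peq_def provable_iff_mcs mcs_Conj mcs_Neg)

lemma provable_Imp_if_peq: "\<phi> \<approx> \<psi> \<Longrightarrow> \<turnstile>\<^sub>M\<^sub>S\<^sub>L \<phi> \<^bold>\<longrightarrow> \<psi>"
  by (simp add: peq_def provable_iff_mcs mcs_Conj mcs_Neg)

lemma peq_refl: "\<phi> \<approx> \<phi>"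
  and peq_sym: "\<phi> \<approx> \<psi> \<Longrightarrow> \<psi> \<approx> \<phi>"
  and peq_trans [trans]: "\<phi> \<approx> \<psi> \<Longrightarrow> \<psi> \<approx> \<chi> \<Longrightarrow> \<phi> \<approx> \<chi>"
  by (auto simp: peq_def)

lemma peq_provable: "\<phi> \<approx> \<psi> \<Longrightarrow> \<turnstile>\<^sub>M\<^sub>S\<^sub>L \<psi> \<Longrightarrow> \<turnstile>\<^sub>M\<^sub>S\<^sub>L \<phi>"
  by (simp add: peq_def provable_iff_mcs)

lemma peq_Neg_Neg: "\<^bold>\<not> \<^bold>\<not> \<phi> \<approx> \<phi>"
  by (simp add: peq_def mcs_Neg)

lemma peq_Neg: "\<phi> \<approx> \<psi> \<Longrightarrow> \<^bold>\<not> \<phi> \<approx> \<^bold>\<not> \<psi>"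
  by (simp add: peq_def mcs_Neg)

lemma peq_Neg_iff: "\<^bold>\<not> \<phi> \<approx> \<^bold>\<not> \<psi> \<longleftrightarrow> \<phi> \<approx> \<psi>"
  by (auto simp: peq_def mcs_Neg)

lemma peq_Conj: "\<phi> \<approx> \<phi>' \<Longrightarrow> \<psi> \<approx> \<psi>' \<Longrightarrow> \<phi> \<^bold>\<and> \<psi> \<approx> \<phi>' \<^bold>\<and> \<psi>'"
  by (simp add: peq_def mcs_Conj)

lemma peq_Dia_Neg_Neg: "\<^bold>\<diamond> \<phi> \<approx> \<^bold>\<diamond> \<^bold>\<not> \<^bold>\<not> \<phi>"
  using peq_trans[OF peq_if_provable_Iff[OF Dual] peq_Neg_Neg] .

text \<open>
  Necessitation and \<open>KBox\<close> make \<open>\<^bold>\<box>\<close> a congruence; as \<open>\<^bold>\<box>\<close> abbreviates \<open>\<^bold>\<not> \<^bold>\<diamond> \<^bold>\<not>\<close>, this only concerns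
  \<open>\<^bold>\<diamond>\<close> in front of a negation. The double negation supplied by \<open>Dual\<close> removes that restriction.
\<close>

lemma peq_Dia:
  assumes "\<phi> \<approx> \<psi>"
  shows "\<^bold>\<diamond> \<phi> \<approx> \<^bold>\<diamond> \<psi>"
proof -
  have box_mono: "\<turnstile>\<^sub>M\<^sub>S\<^sub>L \<^bold>\<box> \<alpha> \<^bold>\<longrightarrow> \<^bold>\<box> \<beta>" if "\<alpha> \<approx> \<beta>" for \<alpha> \<beta> :: "'a fm"
    using MP[OF NecBox[OF provable_Imp_if_peq[OF that]] KBox] .
  have "\<^bold>\<box> \<^bold>\<not> \<phi> \<approx> \<^bold>\<box> \<^bold>\<not> \<psi>"
    using box_mono[OF peq_Neg[OF assms]] box_mono[OF peq_Neg[OF peq_sym[OF assms]]]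
    by (auto simp: peq_def provable_iff_mcs mcs_Imp)
  then have "\<^bold>\<diamond> \<^bold>\<not> \<^bold>\<not> \<phi> \<approx> \<^bold>\<diamond> \<^bold>\<not> \<^bold>\<not> \<psi>"
    by (simp only: peq_Neg_iff)
  then show ?thesis
    by (rule peq_trans[OF peq_trans[OF peq_Dia_Neg_Neg] peq_sym[OF peq_Dia_Neg_Neg]])
qed


section \<open>Reduction of assignments to substitutions\<close>

lemma peq_Assign_Neg: "\<^bold>\<langle>p \<^bold>:= \<chi>\<^bold>\<rangle> \<^bold>\<not> \<phi> \<approx> \<^bold>\<not> \<^bold>\<langle>p \<^bold>:= \<chi>\<^bold>\<rangle> \<phi>"
proof -
  have "\<^bold>\<langle>p \<^bold>:= \<chi>\<^bold>\<rangle> \<phi> \<approx> \<^bold>\<not> \<^bold>[p \<^bold>:= \<chi>\<^bold>] \<^bold>\<not> \<phi>"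
    by (rule peq_if_provable_Iff[OF DualAssign])
  moreover have "\<^bold>[p \<^bold>:= \<chi>\<^bold>] \<^bold>\<not> \<phi> \<approx> \<^bold>\<not> \<^bold>[p \<^bold>:= \<chi>\<^bold>] \<phi>"
    by (rule peq_if_provable_Iff[OF R3])
  ultimately show ?thesis
    by (auto simp: peq_def mcs_Neg)
qed

text \<open>
  An assignment changes the model in a unique way, so its box and its diamond agree. The
  recursion axioms, which speak about the box, thereby become statements about the diamond,
  which is the primitive connective.
\<close>

lemma peq_Assign_Box: "\<^bold>\<langle>p \<^bold>:= \<chi>\<^bold>\<rangle> \<phi> \<approx> \<^bold>[p \<^bold>:= \<chi>\<^bold>] \<phi>"
  using peq_Assign_Neg[of p \<chi> \<phi>] by (auto simp: peq_def mcs_Neg)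

lemma peq_Assign:
  assumes "\<phi> \<approx> \<psi>"
  shows "\<^bold>\<langle>p \<^bold>:= \<chi>\<^bold>\<rangle> \<phi> \<approx> \<^bold>\<langle>p \<^bold>:= \<chi>\<^bold>\<rangle> \<psi>"
proof -
  have box_mono: "\<turnstile>\<^sub>M\<^sub>S\<^sub>L \<^bold>[p \<^bold>:= \<chi>\<^bold>] \<alpha> \<^bold>\<longrightarrow> \<^bold>[p \<^bold>:= \<chi>\<^bold>] \<beta>" if "\<alpha> \<approx> \<beta>" for \<alpha> \<beta>
    using MP[OF NecAssign[OF provable_Imp_if_peq[OF that]] KAssign] .
  have "\<^bold>[p \<^bold>:= \<chi>\<^bold>] \<phi> \<approx> \<^bold>[p \<^bold>:= \<chi>\<^bold>] \<psi>"
    using box_mono[OF assms] box_mono[OF peq_sym[OF assms]]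
    by (auto simp: peq_def provable_iff_mcs mcs_Imp)
  then show ?thesis
    by (rule peq_trans[OF peq_trans[OF peq_Assign_Box] peq_sym[OF peq_Assign_Box]])
qed

lemma peq_Assign_Prop_same: "\<^bold>\<langle>p \<^bold>:= \<chi>\<^bold>\<rangle> Prop p \<approx> \<chi>"
  using peq_trans[OF peq_Assign_Box peq_if_provable_Iff[OF R2]] .

lemma peq_Assign_Prop_other: "q \<noteq> p \<Longrightarrow> \<^bold>\<langle>p \<^bold>:= \<chi>\<^bold>\<rangle> Prop q \<approx> Prop q"
  using peq_trans[OF peq_Assign_Box peq_if_provable_Iff[OF R1]] .

lemma peq_Assign_Conj:
  "\<^bold>\<langle>p \<^bold>:= \<chi>\<^bold>\<rangle> (\<phi> \<^bold>\<and> \<psi>) \<approx> \<^bold>\<langle>p \<^bold>:= \<chi>\<^bold>\<rangle> \<phi> \<^bold>\<and> \<^bold>\<langle>p \<^bold>:= \<chi>\<^bold>\<rangle> \<psi>"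
proof -
  have "\<^bold>\<langle>p \<^bold>:= \<chi>\<^bold>\<rangle> (\<phi> \<^bold>\<and> \<psi>) \<approx> \<^bold>[p \<^bold>:= \<chi>\<^bold>] (\<phi> \<^bold>\<and> \<psi>)"
    by (rule peq_Assign_Box)
  also have "\<dots> \<approx> \<^bold>[p \<^bold>:= \<chi>\<^bold>] \<phi> \<^bold>\<and> \<^bold>[p \<^bold>:= \<chi>\<^bold>] \<psi>"
    by (rule peq_if_provable_Iff[OF R4])
  also have "\<dots> \<approx> \<^bold>\<langle>p \<^bold>:= \<chi>\<^bold>\<rangle> \<phi> \<^bold>\<and> \<^bold>\<langle>p \<^bold>:= \<chi>\<^bold>\<rangle> \<psi>"
    by (intro peq_Conj peq_sym[OF peq_Assign_Box])
  finally show ?thesis .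
qed

lemma peq_Assign_Dia: "\<^bold>\<langle>p \<^bold>:= \<chi>\<^bold>\<rangle> \<^bold>\<diamond> \<phi> \<approx> \<^bold>\<diamond> \<^bold>\<langle>p \<^bold>:= \<chi>\<^bold>\<rangle> \<phi>"
proof -
  \<comment> \<open>\<open>R5\<close> for \<open>\<^bold>\<not> \<phi>\<close> is the claim up to negations, once \<open>\<^bold>\<not>\<close> is moved through the assignment.\<close>
  have "\<^bold>\<not> \<^bold>\<langle>p \<^bold>:= \<chi>\<^bold>\<rangle> \<^bold>\<diamond> \<phi> \<approx> \<^bold>\<not> \<^bold>\<langle>p \<^bold>:= \<chi>\<^bold>\<rangle> \<^bold>\<diamond> \<^bold>\<not> \<^bold>\<not> \<phi>"
    by (intro peq_Neg peq_Assign peq_Dia_Neg_Neg)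
  also have "\<dots> \<approx> \<^bold>\<langle>p \<^bold>:= \<chi>\<^bold>\<rangle> \<^bold>\<box> \<^bold>\<not> \<phi>"
    by (rule peq_sym[OF peq_Assign_Neg])
  also have "\<dots> \<approx> \<^bold>[p \<^bold>:= \<chi>\<^bold>] \<^bold>\<box> \<^bold>\<not> \<phi>"
    by (rule peq_Assign_Box)
  also have "\<dots> \<approx> \<^bold>\<box> \<^bold>[p \<^bold>:= \<chi>\<^bold>] \<^bold>\<not> \<phi>"
    by (rule peq_if_provable_Iff[OF R5])
  also have "\<dots> \<approx> \<^bold>\<not> \<^bold>\<diamond> \<^bold>\<langle>p \<^bold>:= \<chi>\<^bold>\<rangle> \<phi>"
    by (intro peq_Neg peq_Dia peq_sym[OF peq_if_provable_Iff[OF DualAssign]])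
  finally show ?thesis
    by (simp only: peq_Neg_iff)
qed

primrec static :: "'p fm \<Rightarrow> bool" where
  "static (Prop p) \<longleftrightarrow> True"
| "static (\<^bold>\<not> \<phi>) \<longleftrightarrow> static \<phi>"
| "static (\<phi> \<^bold>\<and> \<psi>) \<longleftrightarrow> static \<phi> \<and> static \<psi>"
| "static (\<^bold>\<diamond> \<phi>) \<longleftrightarrow> static \<phi>"
| "static (\<^bold>\<langle>p \<^bold>:= \<psi>\<^bold>\<rangle> \<phi>) \<longleftrightarrow> False"

text \<open>
  Assignments bind their letter, so substitution under them would need renaming. It only
  matters on assignment-free formulas; the last equation is a default value.
\<close>

primrec subst :: "'p \<Rightarrow> 'p fm \<Rightarrow> 'p fm \<Rightarrow> 'p fm" where
  "subst p \<chi> (Prop q) = (if q = p then \<chi> else Prop q)"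
| "subst p \<chi> (\<^bold>\<not> \<phi>) = \<^bold>\<not> subst p \<chi> \<phi>"
| "subst p \<chi> (\<phi> \<^bold>\<and> \<psi>) = subst p \<chi> \<phi> \<^bold>\<and> subst p \<chi> \<psi>"
| "subst p \<chi> (\<^bold>\<diamond> \<phi>) = \<^bold>\<diamond> subst p \<chi> \<phi>"
| "subst p \<chi> (\<^bold>\<langle>q \<^bold>:= \<psi>\<^bold>\<rangle> \<phi>) = \<^bold>\<langle>q \<^bold>:= \<psi>\<^bold>\<rangle> \<phi>"

primrec static_form :: "'p fm \<Rightarrow> 'p fm" where
  "static_form (Prop p) = Prop p"
| "static_form (\<^bold>\<not> \<phi>) = \<^bold>\<not> static_form \<phi>"
| "static_form (\<phi> \<^bold>\<and> \<psi>) = static_form \<phi> \<^bold>\<and> static_form \<psi>"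
| "static_form (\<^bold>\<diamond> \<phi>) = \<^bold>\<diamond> static_form \<phi>"
| "static_form (\<^bold>\<langle>p \<^bold>:= \<psi>\<^bold>\<rangle> \<phi>) = subst p (static_form \<psi>) (static_form \<phi>)"

lemma static_subst: "static \<chi> \<Longrightarrow> static \<phi> \<Longrightarrow> static (subst p \<chi> \<phi>)"
  by (induction \<phi>) auto

lemma static_static_form: "static (static_form \<phi>)"
  by (induction \<phi>) (auto simp: static_subst)

lemma peq_Assign_subst: "static \<phi> \<Longrightarrow> \<^bold>\<langle>p \<^bold>:= \<chi>\<^bold>\<rangle> \<phi> \<approx> subst p \<chi> \<phi>"
proof (induction \<phi>)
  case (Prop q)
  then show ?case by (simp add: peq_Assign_Prop_same peq_Assign_Prop_other)
next
  case (Neg \<phi>)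
  then show ?case using peq_trans[OF peq_Assign_Neg peq_Neg] by simp
next
  case (Conj \<phi> \<psi>)
  then show ?case using peq_trans[OF peq_Assign_Conj peq_Conj] by simp
next
  case (Dia \<phi>)
  then show ?case using peq_trans[OF peq_Assign_Dia peq_Dia] by simp
qed simp

lemma peq_subst: "\<chi> \<approx> \<chi>' \<Longrightarrow> subst p \<chi> \<phi> \<approx> subst p \<chi>' \<phi>"
  by (induction \<phi>) (auto intro: peq_refl peq_Neg peq_Conj peq_Dia)

text \<open>
  The calculus has no rule for replacing equivalents in the assigned formula \<open>\<psi>\<close>. Hence the
  assignment is first turned into a substitution of \<open>\<psi>\<close> itself, and \<open>\<psi>\<close> is reduced only
  afterwards, at its occurrences in the result.
\<close>

lemma peq_static_form: "\<phi> \<approx> static_form \<phi>"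
proof (induction \<phi>)
  case (Assign p \<psi> \<phi>)
  have "\<^bold>\<langle>p \<^bold>:= \<psi>\<^bold>\<rangle> \<phi> \<approx> \<^bold>\<langle>p \<^bold>:= \<psi>\<^bold>\<rangle> static_form \<phi>"
    by (intro peq_Assign Assign)
  also have "\<dots> \<approx> subst p \<psi> (static_form \<phi>)"
    by (intro peq_Assign_subst static_static_form)
  also have "\<dots> \<approx> subst p (static_form \<psi>) (static_form \<phi>)"
    by (intro peq_subst Assign)
  finally show ?case by simp
qed (auto intro: peq_refl peq_Neg peq_Conj peq_Dia)

lemma sat_subst:
  assumes "rel M \<subseteq> worlds M \<times> worlds M"
  shows "static \<phi> \<Longrightarrow> w \<in> worlds M \<Longrightarrow>
    (M, w \<Turnstile> subst p \<chi> \<phi>) \<longleftrightarrow> (M, w \<Turnstile> \<^bold>\<langle>p \<^bold>:= \<chi>\<^bold>\<rangle> \<phi>)"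
  using assms by (induction \<phi> arbitrary: w) auto

lemma sat_static_form:
  assumes "rel M \<subseteq> worlds M \<times> worlds M" "w \<in> worlds M"
  shows "(M, w \<Turnstile> static_form \<phi>) \<longleftrightarrow> (M, w \<Turnstile> \<phi>)"
  using assms
proof (induction \<phi> arbitrary: M w)
  case (Assign p \<psi> \<phi>)
  have "{v \<in> worlds M. M, v \<Turnstile> static_form \<psi>} = {v \<in> worlds M. M, v \<Turnstile> \<psi>}"
    using Assign by auto
  with Assign show ?case
    by (simp add: sat_subst static_static_form)
next
  case (Dia \<phi>)
  then show ?case by simp blast
qed auto


section \<open>Finite countermodels\<close>

lemma derives_Box: "derives {\<psi>. \<^bold>\<box> \<psi> \<in> \<Gamma>} \<phi> \<Longrightarrow> derives \<Gamma> (\<^bold>\<box> \<phi>)"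
proof (induction rule: derives.induct)
  case (mp_derives \<phi> \<psi>)
  then show ?case by (meson derives.mp_derives derives.theorem_derives KBox)
qed (auto intro: theorem_derives hyp_derives NecBox)

definition canonical_rel :: "'p fm set \<Rightarrow> 'p fm set \<Rightarrow> bool" where
  "canonical_rel \<Gamma> \<Delta> \<longleftrightarrow> (\<forall>\<psi>. \<^bold>\<box> \<psi> \<in> \<Gamma> \<longrightarrow> \<psi> \<in> \<Delta>)"

lemma mcs_Dia:
  assumes "mcs \<Gamma>"
  shows "\<^bold>\<diamond> \<phi> \<in> \<Gamma> \<longleftrightarrow> (\<exists>\<Delta>. mcs \<Delta> \<and> canonical_rel \<Gamma> \<Delta> \<and> \<phi> \<in> \<Delta>)"
proof -
  have dual: "\<^bold>\<diamond> \<phi> \<in> \<Gamma> \<longleftrightarrow> \<^bold>\<box> \<^bold>\<not> \<phi> \<notin> \<Gamma>"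
    using peq_Dia_Neg_Neg[of \<phi>] assms by (simp add: peq_def mcs_Neg)
  show ?thesis
  proof
    assume "\<^bold>\<diamond> \<phi> \<in> \<Gamma>"
    then have "\<not> derives {\<psi>. \<^bold>\<box> \<psi> \<in> \<Gamma>} (\<^bold>\<not> \<phi>)"
      using dual derives_Box mcs_closed[OF assms] by blast
    then obtain \<Delta> where \<Delta>: "mcs \<Delta>" "{\<psi>. \<^bold>\<box> \<psi> \<in> \<Gamma>} \<subseteq> \<Delta>" "\<^bold>\<not> \<^bold>\<not> \<phi> \<in> \<Delta>"
      by (rule lindenbaum)
    then show "\<exists>\<Delta>. mcs \<Delta> \<and> canonical_rel \<Gamma> \<Delta> \<and> \<phi> \<in> \<Delta>"
      by (auto simp: canonical_rel_def mcs_Neg)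
  next
    assume "\<exists>\<Delta>. mcs \<Delta> \<and> canonical_rel \<Gamma> \<Delta> \<and> \<phi> \<in> \<Delta>"
    then show "\<^bold>\<diamond> \<phi> \<in> \<Gamma>"
      using dual by (auto simp: canonical_rel_def mcs_Neg)
  qed
qed

primrec subformulas :: "'p fm \<Rightarrow> 'p fm set" where
  "subformulas (Prop p) = {Prop p}"
| "subformulas (\<^bold>\<not> \<phi>) = insert (\<^bold>\<not> \<phi>) (subformulas \<phi>)"
| "subformulas (\<phi> \<^bold>\<and> \<psi>) = insert (\<phi> \<^bold>\<and> \<psi>) (subformulas \<phi> \<union> subformulas \<psi>)"
| "subformulas (\<^bold>\<diamond> \<phi>) = insert (\<^bold>\<diamond> \<phi>) (subformulas \<phi>)"
| "subformulas (\<^bold>\<langle>p \<^bold>:= \<psi>\<^bold>\<rangle> \<phi>) =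
     insert (\<^bold>\<langle>p \<^bold>:= \<psi>\<^bold>\<rangle> \<phi>) (subformulas \<psi> \<union> subformulas \<phi>)"

lemma finite_subformulas: "finite (subformulas \<phi>)"
  by (induction \<phi>) auto

text \<open>
  The function \<open>g\<close> names the world that a maximal consistent set becomes. If it identifies
  exactly the sets that contain the same members of a subformula-closed set, the result is the
  smallest filtration of the canonical model through that set.
\<close>

definition filtration :: "('p fm set \<Rightarrow> 'w) \<Rightarrow> ('w, 'p) model" where
  "filtration g =
     \<lparr>worlds = g ` Collect mcs,
      rel = {(g \<Gamma>, g \<Delta>) | \<Gamma> \<Delta>. mcs \<Gamma> \<and> mcs \<Delta> \<and> canonical_rel \<Gamma> \<Delta>},
      val = \<lambda>p. g ` {\<Gamma>. mcs \<Gamma> \<and> Prop p \<in> \<Gamma>}\<rparr>"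

lemma kripke_model_filtration:
  fixes g :: "'p fm set \<Rightarrow> 'w"
  assumes "mcs (\<Gamma> :: 'p fm set)"
  shows "kripke_model (filtration g)"
  using assms unfolding kripke_model_def filtration_def by auto

lemma filtration_truth:
  assumes g: "\<And>\<Gamma> \<Delta>. g \<Gamma> = g \<Delta> \<Longrightarrow> \<Gamma> \<inter> S = \<Delta> \<inter> S"
  shows "static \<phi> \<Longrightarrow> subformulas \<phi> \<subseteq> S \<Longrightarrow> mcs \<Gamma> \<Longrightarrow>
    (filtration g, g \<Gamma> \<Turnstile> \<phi>) \<longleftrightarrow> \<phi> \<in> \<Gamma>"
proof (induction \<phi> arbitrary: \<Gamma>)
  case (Prop p)
  then show ?case using g by (fastforce simp: filtration_def)
next
  case (Neg \<phi>)
  then show ?case by (simp add: mcs_Neg)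
next
  case (Conj \<phi> \<psi>)
  then show ?case by (simp add: mcs_Conj)
next
  case (Dia \<phi>)
  have IH: "(filtration g, g \<Delta> \<Turnstile> \<phi>) \<longleftrightarrow> \<phi> \<in> \<Delta>" if "mcs \<Delta>" for \<Delta>
    using Dia that by simp
  show ?case
  proof
    assume "filtration g, g \<Gamma> \<Turnstile> \<^bold>\<diamond> \<phi>"
    then obtain v where "(g \<Gamma>, v) \<in> rel (filtration g)" "filtration g, v \<Turnstile> \<phi>"
      by auto
    then obtain \<Gamma>' \<Delta> where "g \<Gamma> = g \<Gamma>'" "mcs \<Gamma>'" "mcs \<Delta>" "canonical_rel \<Gamma>' \<Delta>"
      "filtration g, g \<Delta> \<Turnstile> \<phi>"
      by (auto simp: filtration_def)
    then have "\<^bold>\<diamond> \<phi> \<in> \<Gamma>'"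
      using IH mcs_Dia by blast
    \<comment> \<open>\<open>\<Gamma>\<close> itself need not see \<open>\<Delta>\<close>, but it agrees with \<open>\<Gamma>'\<close> on \<open>\<^bold>\<diamond> \<phi>\<close>.\<close>
    then show "\<^bold>\<diamond> \<phi> \<in> \<Gamma>"
      using g[OF \<open>g \<Gamma> = g \<Gamma>'\<close>] Dia.prems by auto
  next
    assume "\<^bold>\<diamond> \<phi> \<in> \<Gamma>"
    then obtain \<Delta> where "mcs \<Delta>" "canonical_rel \<Gamma> \<Delta>" "\<phi> \<in> \<Delta>"
      using mcs_Dia Dia.prems by blast
    then show "filtration g, g \<Gamma> \<Turnstile> \<^bold>\<diamond> \<phi>"
      using IH Dia.prems by (auto simp: filtration_def)
  qed
qed simp

text \<open>
  A maximal consistent set only counts through its trace on the subformulas of \<open>\<phi>\<close>. There are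
  finitely many traces, so an infinite type has room for all of them.
\<close>

lemma countermodel:
  assumes "static \<phi>" "\<not> \<turnstile>\<^sub>M\<^sub>S\<^sub>L \<phi>"
  obtains M :: "('w::infinite, 'p) model" and w
  where "kripke_model M" "w \<in> worlds M" "\<not> (M, w \<Turnstile> \<phi>)"
proof -
  let ?S = "subformulas \<phi>"
  have "finite (Pow ?S)"
    by (simp add: finite_subformulas)
  moreover obtain B :: "'w set" where "finite B" "card B = card (Pow ?S)"
    using infinite_arbitrarily_large[OF infinite_UNIV] by blast
  ultimately obtain h :: "'p fm set \<Rightarrow> 'w" where h: "bij_betw h (Pow ?S) B"
    using finite_same_card_bij by metis
  define g where "g \<Gamma> = h (\<Gamma> \<inter> ?S)" for \<Gamma>
  have g: "\<Gamma> \<inter> ?S = \<Delta> \<inter> ?S" if "g \<Gamma> = g \<Delta>" for \<Gamma> \<Delta>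
    using inj_onD[OF bij_betw_imp_inj_on[OF h]] that unfolding g_def by blast
  obtain \<Gamma> where \<Gamma>: "mcs \<Gamma>" "\<phi> \<notin> \<Gamma>"
    using assms(2) provable_iff_mcs by blast
  show thesis
  proof (rule that)
    show "kripke_model (filtration g)"
      using \<Gamma> by (intro kripke_model_filtration)
    show "g \<Gamma> \<in> worlds (filtration g)"
      using \<Gamma> by (simp add: filtration_def)
    show "\<not> (filtration g, g \<Gamma> \<Turnstile> \<phi>)"
      using filtration_truth[OF g assms(1) order_refl] \<Gamma> by blast
  qed
qed


section \<open>Completeness\<close>

theorem theorem2p8:
  fixes \<phi> :: "'p::countable fm"
  assumes "valid TYPE('w::infinite) \<phi>"
  shows "\<turnstile>\<^sub>M\<^sub>S\<^sub>L \<phi>"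
proof (rule ccontr)
  assume "\<not> \<turnstile>\<^sub>M\<^sub>S\<^sub>L \<phi>"
  then have "\<not> \<turnstile>\<^sub>M\<^sub>S\<^sub>L static_form \<phi>"
    using peq_provable[OF peq_static_form] by blast
  then obtain M :: "('w, 'p) model" and w
    where M: "kripke_model M" "w \<in> worlds M" "\<not> (M, w \<Turnstile> static_form \<phi>)"
    using countermodel[OF static_static_form] by blast
  then have "\<not> (M, w \<Turnstile> \<phi>)"
    using sat_static_form[of M w \<phi>] by (simp add: kripke_model_def)
  with assms M show False
    by (auto simp: valid_def)
qed

end
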